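(* Let $F_4$ be the subgroup of Thompson's group $F$ consisting of those elements that have a rigid coloring. Then $F_4$ consists of those elements of $F$ which, when viewed as self homeomorphisms of $[0,1]$, use only slopes that are integral powers of $4$.
   Context: **Trees.** Finite binary trees are rooted, planar; every vertex has $0$ or two (ordered: left, right) children except the root $*$, which has degree $1$ and a single child $\emptyset$ (non-root vertices are addressed by words over $\{0,1\}$, the children of $u$ being $u0$ and $u1$). Leaves are numbered left to right; internal vertices are the vertices of degree $3$. All pairs $(D,R)$ of trees are assumed to have the same number of leaves. **The group $F$.** To each word $w$ associate an interval $i(w)\subseteq[0,1]$ by $i(\emptyset)=[0,1]$, with $i(w0)$, $i(w1)$ the left and right halves of $i(w)$. If $(D,R)$ is a pair of trees with $n$ leaves and $I_1,\dots,I_n$, $J_1,\dots,J_n$ are the intervals of the leaves of $D$ and of $R$ in left-right order, then $(D,R)$ defines the homeomorphism of $[0,1]$ taking $I_j$ affinely onto $J_j$, preserving orientation, for each $j$. $F$ is the group of all homeomorphisms so obtained, under composition; several pairs can represent the same element. **Colorings.** Colors are elements of $\mathbb Z_2\times\mathbb Z_2$, coded $0=(0,0)$, $1=(0,1)$, $2=(1,0)$, $3=(1,1)$. A color vector $\mathbf c=(c_1,\dots,c_n)$ for a tree with $n$ leaves determines the unique edge coloring in which the edge at the $i$-th leaf has color $c_i$ and the three edges at each internal vertex sum to $0$. It is valid for the tree if this is a proper edge coloring using only colors $1,2,3$; it is a coloring of a pair $(D,R)$ if it is valid for both trees. A valid color vector gives each internal vertex a derived sign: $+$ if the colors of its (parent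 edge, left child edge, right child edge) form a cyclic permutation of $(1,2,3)$, and $-$ otherwise. A sign assignment is rigid if any two adjacent internal vertices have opposite signs. A coloring of $(D,R)$ is rigid if its derived sign assignments on $D$ and $R$ are rigid (rigidity on one of the two trees is equivalent to rigidity on the other). An element of $F$ has a rigid coloring if a pair representing it has a rigid coloring. *)

theory Defs
  imports "HOL-Analysis.Analysis" "HOL-Library.Z2" "HOL-Algebra.Bij"
begin

text \<open>
  A term of type \<open>bintree\<close> is the part of a tree hanging at the vertex \<open>\<emptyset>\<close>; the
  degree-one root \<open>*\<close> above it is left implicit.  Non-root vertices are words
  (\<open>False\<close> for the letter 0, \<open>True\<close> for 1).  Every edge is named by its lower endpoint,
  so the edge joining \<open>*\<close> to \<open>\<emptyset>\<close> is named by \<open>[]\<close>.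
\<close>

datatype bintree = Leaf | Node bintree bintree

type_synonym word = "bool list"

primrec leaves :: "bintree \<Rightarrow> word list" where
  "leaves Leaf = [[]]"
| "leaves (Node l r) = map (Cons False) (leaves l) @ map (Cons True) (leaves r)"

primrec internals :: "bintree \<Rightarrow> word set" where
  "internals Leaf = {}"
| "internals (Node l r) = insert [] (Cons False ` internals l \<union> Cons True ` internals r)"

definition vertices :: "bintree \<Rightarrow> word set" where
  "vertices T = set (leaves T) \<union> internals T"

definition num_leaves :: "bintree \<Rightarrow> nat" where
  "num_leaves T = length (leaves T)"


section \<open>Thompson's group F\<close>

text \<open>The endpoints of \<open>i(w)\<close>: reading a letter replaces the interval by its left or right half.\<close>

definition endpoints :: "word \<Rightarrow> real \<times> real" where
  "endpoints w = foldl (\<lambda>(a, b) x. if x then ((a + b) / 2, b) else (a, (a + b) / 2)) (0, 1) w"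

definition interval :: "word \<Rightarrow> real set" where
  "interval w = {fst (endpoints w)..snd (endpoints w)}"

definition maps_affinely_onto :: "(real \<Rightarrow> real) \<Rightarrow> real set \<Rightarrow> real set \<Rightarrow> bool" where
  "maps_affinely_onto f I J \<longleftrightarrow> (\<exists>a b. a > 0 \<and> (\<forall>x\<in>I. f x = a * x + b)) \<and> f ` I = J"

text \<open>
  Self-maps of \<open>[0,1]\<close> are functions on the reals that are extensional on \<open>{0..1}\<close>
  (\<open>undefined\<close> elsewhere), the convention of \<^const>\<open>Bij\<close> and \<^const>\<open>BijGroup\<close>.
  The leaf intervals of a tree cover \<open>[0,1]\<close>, so \<open>represents D R f\<close> determines \<open>f\<close> and
  forces it to be an increasing homeomorphism of \<open>[0,1]\<close>.
\<close>

definition represents :: "bintree \<Rightarrow> bintree \<Rightarrow> (real \<Rightarrow> real) \<Rightarrow> bool" where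
  "represents D R f \<longleftrightarrow>
     num_leaves D = num_leaves R \<and>
     f \<in> extensional {0..1} \<and>
     (\<forall>j<num_leaves D. maps_affinely_onto f (interval (leaves D ! j)) (interval (leaves R ! j)))"

definition thompson_F :: "(real \<Rightarrow> real) monoid" where
  "thompson_F = (BijGroup {0..1}) \<lparr>carrier := {f. \<exists>D R. represents D R f}\<rparr>"

text \<open>
  For a piecewise affine map the derivatives at its points of differentiability
  are precisely the slopes of its affine pieces.
\<close>

definition slopes :: "(real \<Rightarrow> real) \<Rightarrow> real set" where
  "slopes f = {s. \<exists>x\<in>{0<..<1}. (f has_real_derivative s) (at x)}"


section \<open>Colorings\<close>

type_synonym color = "bit \<times> bit"

abbreviation color1 :: color where "color1 \<equiv> (0, 1)"
abbreviation color2 :: color where "color2 \<equiv> (1, 0)"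
abbreviation color3 :: color where "color3 \<equiv> (1, 1)"

definition edge_coloring :: "bintree \<Rightarrow> color list \<Rightarrow> (word \<Rightarrow> color) \<Rightarrow> bool" where
  "edge_coloring T c \<kappa> \<longleftrightarrow>
     length c = num_leaves T \<and>
     (\<forall>j<num_leaves T. \<kappa> (leaves T ! j) = c ! j) \<and>
     (\<forall>u\<in>internals T. \<kappa> u + \<kappa> (u @ [False]) + \<kappa> (u @ [True]) = 0)"

text \<open>
  By \<open>edge_coloring_exists\<close> and \<open>edge_coloring_unique\<close>, the edge coloring determined by a
  color vector exists and is unique on the edges of the tree, so the existential quantifiers
  over \<open>\<kappa>\<close> further down select that coloring.
\<close>

lemma edge_coloring_Node:
  "edge_coloring (Node l r) c \<kappa> \<longleftrightarrow>
     length c = num_leaves (Node l r) \<and>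
     edge_coloring l (take (num_leaves l) c) (\<lambda>w. \<kappa> (False # w)) \<and>
     edge_coloring r (drop (num_leaves l) c) (\<lambda>w. \<kappa> (True # w)) \<and>
     \<kappa> [] + \<kappa> [False] + \<kappa> [True] = 0"
proof -
  have split: "(\<forall>j<m + n. P j) \<longleftrightarrow> (\<forall>j<m. P j) \<and> (\<forall>j<n. P (m + j))" for P and m n :: nat
    by (metis add_less_cancel_left le_add_diff_inverse linorder_not_less trans_less_add1)
  show ?thesis
    by (auto simp: edge_coloring_def num_leaves_def split nth_append ball_Un)
qed

lemma edge_coloring_exists:
  assumes "length c = num_leaves T"
  shows "\<exists>\<kappa>. edge_coloring T c \<kappa>"
  using assms
proof (induction T arbitrary: c)
  case Leaf
  then show ?case
    by (intro exI[of _ "\<lambda>_. hd c"])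
      (cases c; simp add: edge_coloring_def num_leaves_def)
next
  case (Node l r)
  let ?n = "num_leaves l"
  have "length (take ?n c) = num_leaves l" "length (drop ?n c) = num_leaves r"
    using Node.prems by (auto simp: num_leaves_def)
  then obtain k1 k2 where k: "edge_coloring l (take ?n c) k1" "edge_coloring r (drop ?n c) k2"
    using Node.IH by meson
  define \<kappa> where "\<kappa> = (\<lambda>w. case w of [] \<Rightarrow> - k1 [] - k2 [] | x # v \<Rightarrow> if x then k2 v else k1 v)"
  have "edge_coloring (Node l r) c \<kappa>"
    using k Node.prems by (simp add: edge_coloring_Node \<kappa>_def)
  then show ?case by blast
qed

lemma edge_coloring_unique:
  assumes "edge_coloring T c \<kappa>" "edge_coloring T c \<kappa>'" "v \<in> vertices T"
  shows "\<kappa> v = \<kappa>' v"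
  using assms
proof (induction T arbitrary: c \<kappa> \<kappa>' v)
  case Leaf
  then show ?case by (simp add: edge_coloring_def num_leaves_def vertices_def)
next
  case (Node l r)
  have l: "\<kappa> (False # w) = \<kappa>' (False # w)" if "w \<in> vertices l" for w
    using Node.IH(1)[of _ "\<lambda>w. \<kappa> (False # w)" "\<lambda>w. \<kappa>' (False # w)" w] Node.prems that
    unfolding edge_coloring_Node by blast
  have r: "\<kappa> (True # w) = \<kappa>' (True # w)" if "w \<in> vertices r" for w
    using Node.IH(2)[of _ "\<lambda>w. \<kappa> (True # w)" "\<lambda>w. \<kappa>' (True # w)" w] Node.prems that
    unfolding edge_coloring_Node by blast
  have nil: "[] \<in> vertices t" for t by (cases t) (auto simp: vertices_def)
  have "\<kappa> [] + \<kappa> [False] + \<kappa> [True] = \<kappa>' [] + \<kappa>' [False] + \<kappa>' [True]"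
    using Node.prems unfolding edge_coloring_Node by simp
  then have "\<kappa> [] = \<kappa>' []" using l[OF nil] r[OF nil] by simp
  moreover have "v = [] \<or> (\<exists>w\<in>vertices l. v = False # w) \<or> (\<exists>w\<in>vertices r. v = True # w)"
    using Node.prems(3) by (auto simp: vertices_def)
  ultimately show ?case using l r by auto
qed

text \<open>
  Two edges can only meet at an internal vertex, the root and the leaves having degree one.
\<close>

definition proper_edge_coloring :: "bintree \<Rightarrow> (word \<Rightarrow> color) \<Rightarrow> bool" where
  "proper_edge_coloring T \<kappa> \<longleftrightarrow>
     (\<forall>u\<in>internals T. distinct [\<kappa> u, \<kappa> (u @ [False]), \<kappa> (u @ [True])])"

definition valid_coloring :: "bintree \<Rightarrow> color list \<Rightarrow> bool" where
  "valid_coloring T c \<longleftrightarrow>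
     (\<exists>\<kappa>. edge_coloring T c \<kappa> \<and> proper_edge_coloring T \<kappa> \<and>
          (\<forall>v\<in>vertices T. \<kappa> v \<in> {color1, color2, color3}))"

datatype sign = Plus | Minus

definition derived_sign :: "(word \<Rightarrow> color) \<Rightarrow> word \<Rightarrow> sign" where
  "derived_sign \<kappa> u =
     (if (\<kappa> u, \<kappa> (u @ [False]), \<kappa> (u @ [True])) \<in>
           {(color1, color2, color3), (color2, color3, color1), (color3, color1, color2)}
      then Plus else Minus)"

definition rigid_signs :: "bintree \<Rightarrow> (word \<Rightarrow> sign) \<Rightarrow> bool" where
  "rigid_signs T \<sigma> \<longleftrightarrow>
     (\<forall>u\<in>internals T. \<forall>x. u @ [x] \<in> internals T \<longrightarrow> \<sigma> u \<noteq> \<sigma> (u @ [x]))"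

definition rigid_on :: "bintree \<Rightarrow> color list \<Rightarrow> bool" where
  "rigid_on T c \<longleftrightarrow> (\<exists>\<kappa>. edge_coloring T c \<kappa> \<and> rigid_signs T (derived_sign \<kappa>))"

definition coloring_of_pair :: "bintree \<Rightarrow> bintree \<Rightarrow> color list \<Rightarrow> bool" where
  "coloring_of_pair D R c \<longleftrightarrow> valid_coloring D c \<and> valid_coloring R c"

definition rigid_coloring :: "bintree \<Rightarrow> bintree \<Rightarrow> color list \<Rightarrow> bool" where
  "rigid_coloring D R c \<longleftrightarrow> coloring_of_pair D R c \<and> rigid_on D c \<and> rigid_on R c"

definition has_rigid_coloring :: "(real \<Rightarrow> real) \<Rightarrow> bool" where
  "has_rigid_coloring f \<longleftrightarrow> (\<exists>D R c. represents D R f \<and> rigid_coloring D R c)"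

definition F4 :: "(real \<Rightarrow> real) set" where
  "F4 = {f \<in> carrier thompson_F. has_rigid_coloring f}"

end

theory Submission
  imports Defs
begin

text \<open>
  Color the dyadic points of \<open>[0,1]\<close> with 1, 2, 3 so that the two endpoints and the midpoint of
  every standard dyadic interval receive three different colors.  Such a coloring is determined by
  the colors of 0 and 1, because three distinct colors have sum 0 and the midpoint therefore
  gets the sum of the colors of the endpoints.  (One such coloring is the reduction of dyadic
  rationals modulo 3, where 2 is invertible and equals -1.)  Give the edge above the vertex \<open>w\<close> the
  sum of the two endpoint colors of \<open>i(w)\<close>.  At an internal vertex the three edges then carry three
  different colors, and the sign of the vertex is the orientation, cyclic or anticyclic, of the
  pair of endpoint colors.  Halving an interval replaces one endpoint by the third color and
  reverses this orientation, so that the edge coloring is rigid.  Conversely, rigidity leaves no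
  choice below the first internal vertex, and every rigid coloring of a tree arises in this way
  (\<open>subdivision_coloring_rigid\<close>, \<open>rigid_coloring_is_subdivision\<close>).

  The orientation at a leaf is thus the orientation at the root, reversed once for each level of
  depth.  If corresponding leaves of \<open>D\<close> and \<open>R\<close> have depths of the same parity, start both trees
  with the same colors of 0 and 1: the orientations at corresponding leaves agree, and walking from
  left to right one finds that the endpoint colors, and so the leaf colors, agree too.  Conversely,
  suppose that two such colorings of \<open>D\<close> and \<open>R\<close> agree on the leaves.  A pair of endpoint colors
  is determined by its sum up to order; consecutive leaf intervals share an endpoint,
  and so the two orders agree at all leaves or at none.  The sum of all leaf colors is the sum of
  the colors of 0 and 1, so that the same alternative holds at the root.  Hence the parities of the
  depths agree.  In short, \<open>(D, R)\<close> has a rigid coloring if and only if corresponding leaves have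
  depths of the same parity (\<open>ex_rigid_coloring_iff\<close>).

  The homeomorphism given by \<open>(D, R)\<close> has slope \<open>2^(|u| - |v|)\<close> on the interval of a leaf \<open>u\<close> of \<open>D\<close>
  that corresponds to the leaf \<open>v\<close> of \<open>R\<close>.  This is a power of 4 exactly if the depths have the
  same parity, which gives the description of \<open>F4\<close> by slopes.  That \<open>F4\<close> is a subgroup is also
  read off from the parities: they survive exchanging the two trees and
  expanding both trees alike, and any two pairs can be expanded so that the range tree of one is
  the domain tree of the other.
\<close>

section \<open>Repeated subdivision of a pair of endpoints\<close>

text \<open>
  Both the endpoints of \<open>i(w)\<close> and their colors arise by this rule, with \<open>m\<close> giving the value at the
  midpoint: \<open>m\<close> is the arithmetic mean for the former, the sum of colors for the latter.
\<close>

definition subdivide :: "('a \<Rightarrow> 'a \<Rightarrow> 'a) \<Rightarrow> 'a \<times> 'a \<Rightarrow> word \<Rightarrow> 'a \<times> 'a" where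
  "subdivide m = foldl (\<lambda>e x. if x then (m (fst e) (snd e), snd e) else (fst e, m (fst e) (snd e)))"

lemma subdivide_Nil [simp]: "subdivide m e [] = e"
  by (simp add: subdivide_def)

lemma subdivide_Cons [simp]:
  "subdivide m e (x # w) =
     subdivide m (if x then (m (fst e) (snd e), snd e) else (fst e, m (fst e) (snd e))) w"
  by (simp add: subdivide_def)

lemma subdivide_append: "subdivide m e (v @ w) = subdivide m (subdivide m e v) w"
  by (simp add: subdivide_def)

text \<open>
  Meant for the endpoint pairs of the leaves of a tree in left-right order, with \<open>p\<close> and \<open>q\<close> the
  endpoints at the root (\<open>chain_leaves\<close>).
\<close>

primrec chain :: "'a \<Rightarrow> ('a \<times> 'a) list \<Rightarrow> 'a \<Rightarrow> bool" where
  "chain p [] q \<longleftrightarrow> p = q"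
| "chain p (e # es) q \<longleftrightarrow> fst e = p \<and> chain (snd e) es q"

lemma chain_append: "chain p es r \<Longrightarrow> chain r fs q \<Longrightarrow> chain p (es @ fs) q"
  by (induction es arbitrary: p) auto

lemma chain_leaves: "chain (fst e) (map (subdivide m e) (leaves T)) (snd e)"
proof (induction T arbitrary: e)
  case Leaf
  then show ?case by simp
next
  case (Node l r)
  show ?case
    using Node.IH(1)[of "(fst e, m (fst e) (snd e))"] Node.IH(2)[of "(m (fst e) (snd e), snd e)"]
    by (auto intro!: chain_append simp: comp_def)
qed

section \<open>Colors on the endpoints\<close>

text \<open>
  For two different nonzero colors the sum is the remaining nonzero color.  It serves both as the
  color of the midpoint and as the color of the edge.
\<close>

definition third :: "color \<times> color \<Rightarrow> color" where
  "third e = fst e + snd e"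

definition nondegenerate :: "color \<times> color \<Rightarrow> bool" where
  "nondegenerate e \<longleftrightarrow> fst e \<noteq> 0 \<and> snd e \<noteq> 0 \<and> fst e \<noteq> snd e"

text \<open>
  If \<open>e\<close> holds the endpoint colors at a vertex, the edges to its parent, left child and right child
  have the colors \<open>third e\<close>, \<open>snd e\<close> and \<open>fst e\<close>: the left half ends in the midpoint, and the sum
  of its endpoint colors is \<open>fst e + third e = snd e\<close>.  So this is the derived sign of the
  vertex.
\<close>

definition positive :: "color \<times> color \<Rightarrow> bool" where
  "positive e \<longleftrightarrow> (third e, snd e, fst e) \<in>
     {(color1, color2, color3), (color2, color3, color1), (color3, color1, color2)}"

lemma color_cases:
  fixes a :: color
  obtains "a = (0, 0)" | "a = color1" | "a = color2" | "a = color3"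
  by (metis bit.exhaust prod.exhaust)

lemma nonzero_color_cases:
  fixes a :: color
  assumes "a \<noteq> 0"
  obtains "a = color1" | "a = color2" | "a = color3"
  using assms by (cases a rule: color_cases) (auto simp: zero_prod_def)

lemma nondegenerate_cases:
  assumes "nondegenerate (a, b)"
  obtains "a = color1" "b = color2" | "a = color2" "b = color3" | "a = color3" "b = color1"
    | "a = color2" "b = color1" | "a = color3" "b = color2" | "a = color1" "b = color3"
proof -
  have "a \<noteq> 0" "b \<noteq> 0" "a \<noteq> b" using assms by (auto simp: nondegenerate_def)
  then show thesis
    using that by (elim nonzero_color_cases) auto
qed

lemma color_add_self: "a + (a + b) = b" "a + b + b = a" "a + b + a = b" for a b :: color
  by (cases a rule: color_cases; cases b rule: color_cases; simp)+

lemma color_double: "a + b + b + a = 0" for a b :: color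
  by (cases a rule: color_cases; cases b rule: color_cases; simp add: zero_prod_def)

lemma halves_nondegenerate:
  assumes "nondegenerate (a, b)"
  shows "nondegenerate (a + b, b)" "nondegenerate (a, a + b)"
    and "positive (a + b, b) \<longleftrightarrow> \<not> positive (a, b)" "positive (a, a + b) \<longleftrightarrow> \<not> positive (a, b)"
  by (rule nondegenerate_cases[OF assms];
      simp add: nondegenerate_def positive_def third_def zero_prod_def)+

lemma subdivide_nondegenerate:
  assumes "nondegenerate e"
  shows "nondegenerate (subdivide (+) e w)"
    and "positive (subdivide (+) e w) \<longleftrightarrow> positive e = even (length w)"
proof -
  have "nondegenerate (subdivide (+) e w) \<and>
      (positive (subdivide (+) e w) \<longleftrightarrow> positive e = even (length w))"
    using assms
  proof (induction w arbitrary: e)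
    case Nil
    then show ?case by simp
  next
    case (Cons x w)
    then show ?case
      using halves_nondegenerate[of "fst e" "snd e"] by auto
  qed
  then show "nondegenerate (subdivide (+) e w)"
    and "positive (subdivide (+) e w) \<longleftrightarrow> positive e = even (length w)"
    by auto
qed

text \<open>
  Two such pairs with the same sum are equal or reversed, and reversal changes the orientation.
\<close>

lemma same_third:
  assumes "nondegenerate (p, q)" "nondegenerate (p', q')" "third (p, q) = third (p', q')"
  shows "p = p' \<longleftrightarrow> q = q'" "positive (p, q) = positive (p', q') \<longleftrightarrow> p = p'"
  by (rule nondegenerate_cases[OF assms(1)]; rule nondegenerate_cases[OF assms(2)];
      use assms(3) in \<open>simp add: positive_def third_def\<close>)+

lemma same_positive:
  assumes "nondegenerate (p, q)" "nondegenerate (p, q')" "positive (p, q) = positive (p, q')"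
  shows "q = q'"
  by (rule nondegenerate_cases[OF assms(1)]; rule nondegenerate_cases[OF assms(2)];
      use assms(3) in \<open>simp add: positive_def third_def\<close>)

text \<open>
  The sum telescopes because every color is its own negative.
\<close>

lemma chain_sum: "chain p es q \<Longrightarrow> p + q = sum_list (map third es)"
proof (induction es arbitrary: p)
  case Nil
  then show ?case using color_add_self(1)[of q 0] by simp
next
  case (Cons e es)
  then have "sum_list (map third es) = snd e + q" "p = fst e" by auto
  then show ?case by (simp add: third_def[of e] add.assoc color_add_self(1))
qed

text \<open>
  By \<open>same_third\<close> the pairs at corresponding positions are equal or reversed.  Their right
  endpoints are the left endpoints of the next pairs, so that which of the two cases occurs does not
  change along the chain.
\<close>

lemma chain_same_thirds:
  assumes "list_all2 (\<lambda>e e'. nondegenerate e \<and> nondegenerate e' \<and> third e = third e') es es'"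
    and "chain p es q" "chain p' es' q'"
  shows "list_all2 (\<lambda>e e'. positive e = positive e' \<longleftrightarrow> p = p') es es'"
  using assms
proof (induction es es' arbitrary: p p' rule: list_all2_induct)
  case Nil
  then show ?case by simp
next
  case (Cons e es e' es')
  have "(fst e = fst e') = (snd e = snd e')" "(positive e = positive e') = (fst e = fst e')"
    using same_third[of "fst e" "snd e" "fst e'" "snd e'"] Cons.hyps by auto
  then show ?case
    using Cons.IH[of "snd e" "snd e'"] Cons.prems by simp
qed

text \<open>
  The left endpoint color and the orientation determine the right endpoint color, which is the left
  endpoint color at the next position.
\<close>

lemma chain_same_positive:
  assumes "list_all2 (\<lambda>e e'. nondegenerate e \<and> nondegenerate e' \<and> positive e = positive e') es es'"
    and "chain p es q" "chain p es' q'"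
  shows "es = es'"
  using assms
proof (induction es es' arbitrary: p rule: list_all2_induct)
  case Nil
  then show ?case by simp
next
  case (Cons e es e' es')
  have "fst e = fst e'" using Cons.prems by simp
  moreover have "snd e = snd e'"
    using same_positive[of "fst e" "snd e" "snd e'"] Cons.hyps Cons.prems
    by (metis chain.simps(2) prod.collapse)
  ultimately have "e = e'" by (rule prod_eqI)
  then show ?case
    using Cons.IH[of "snd e"] Cons.prems by simp
qed

section \<open>Rigid colorings\<close>

lemma Nil_in_vertices: "[] \<in> vertices T"
  by (cases T) (auto simp: vertices_def)

lemma snoc_in_vertices_iff: "w @ [x] \<in> vertices T \<longleftrightarrow> w \<in> internals T"
proof (induction T arbitrary: w)
  case Leaf
  then show ?case by (simp add: vertices_def)
next
  case (Node l r)
  have "(y # v \<in> vertices (Node l r)) = (v \<in> vertices (if y then r else l))" for y v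
    by (auto simp: vertices_def)
  moreover have "[y] \<in> vertices (Node l r)" for y
    using calculation[of y "[]"] Nil_in_vertices by simp
  ultimately show ?case
    using Node.IH by (cases w) (auto split: if_splits)
qed

lemma internals_snoc_imp: "w @ [x] \<in> internals T \<Longrightarrow> w \<in> internals T"
  using snoc_in_vertices_iff[of w x T] by (simp add: vertices_def)

text \<open>
  The step that makes rigid colorings unique.  Here \<open>p\<close>, \<open>q\<close> are the colors of the right and left
  child edges of a vertex and \<open>z\<close>, \<open>y\<close> those of one of these children, which is the right child in
  the first and the left child in the second conclusion.  The parent edge of the child leaves two
  orders for \<open>y\<close> and \<open>z\<close>, and the opposite sign selects the one given by subdivision.
\<close>

lemma opposite_triple:
  fixes p q y z :: color
  assumes "nondegenerate (p, q)" "y \<noteq> 0" "z \<noteq> 0"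
    and "positive (z, y) \<longleftrightarrow> \<not> positive (p, q)"
  shows "p + y + z = 0 \<Longrightarrow> z = p + q \<and> y = q"
    and "q + y + z = 0 \<Longrightarrow> z = p \<and> y = p + q"
  by (rule nondegenerate_cases[OF assms(1)];
      rule nonzero_color_cases[OF assms(2)]; rule nonzero_color_cases[OF assms(3)];
      use assms(4) in \<open>simp add: positive_def third_def zero_prod_def\<close>)+

lemma derived_sign_positive:
  assumes "\<kappa> u = third (\<kappa> (u @ [True]), \<kappa> (u @ [False]))"
  shows "derived_sign \<kappa> u = (if positive (\<kappa> (u @ [True]), \<kappa> (u @ [False])) then Plus else Minus)"
  using assms by (simp add: derived_sign_def positive_def)

text \<open>
  Each step from a vertex to a child reverses the orientation of the endpoint colors, which is the
  derived sign.
\<close>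

lemma subdivision_coloring_rigid:
  fixes T :: bintree
  assumes e: "nondegenerate e"
  defines "c \<equiv> map (third \<circ> subdivide (+) e) (leaves T)"
  shows "valid_coloring T c" "rigid_on T c"
proof -
  define E where "E = subdivide (+) e"
  define \<kappa> where "\<kappa> = third \<circ> E"
  have nd: "nondegenerate (E w)" and pos: "positive (E w) \<longleftrightarrow> positive e = even (length w)" for w
    using subdivide_nondegenerate[OF e] by (auto simp: E_def)
  have children: "\<kappa> (w @ [True]) = fst (E w)" "\<kappa> (w @ [False]) = snd (E w)" for w
    by (simp_all add: \<kappa>_def E_def third_def subdivide_append color_add_self)
  have col: "\<kappa> w = fst (E w) + snd (E w)" for w
    by (simp add: \<kappa>_def third_def)
  have fold: "third (subdivide (+) e w) = \<kappa> w" for w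
    by (simp add: \<kappa>_def E_def)
  have ec: "edge_coloring T c \<kappa>"
    by (simp add: edge_coloring_def num_leaves_def c_def fold children)
      (simp add: col color_double)
  have triple: "distinct [0, fst (E w) + snd (E w), snd (E w), fst (E w)]" for w
    using halves_nondegenerate(1,2)[of "fst (E w)" "snd (E w)"] nd[of w]
    by (simp add: nondegenerate_def) metis
  have "\<kappa> w \<noteq> 0" for w
    using triple[of w] by (simp add: col)
  then have "\<kappa> w \<in> {color1, color2, color3}" for w
    by (metis color_cases insert_iff zero_prod_def)
  moreover have "proper_edge_coloring T \<kappa>"
    using triple by (simp add: proper_edge_coloring_def children) (simp add: col)
  ultimately show "valid_coloring T c"
    using ec by (auto simp: valid_coloring_def)
  have "derived_sign \<kappa> w = (if positive e = even (length w) then Plus else Minus)" for w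
    using derived_sign_positive[of \<kappa> w, unfolded children] pos[of w] col[of w]
    by (simp add: third_def)
  then show "rigid_on T c"
    using ec unfolding rigid_on_def rigid_signs_def by (intro exI[of _ \<kappa>]) auto
qed

text \<open>
  The endpoint colors at the root can be read off: by the remark on \<open>positive\<close> they are the colors
  of the edges to the right and left child of \<open>\<emptyset>\<close>.  For a tree without internal vertices any two
  colors with the right sum will do.  Everything further down is forced by \<open>opposite_triple\<close>.
\<close>

lemma rigid_coloring_is_subdivision:
  assumes valid: "valid_coloring T c" and rigid: "rigid_on T c"
  shows "\<exists>e. nondegenerate e \<and> c = map (third \<circ> subdivide (+) e) (leaves T)"
proof -
  obtain \<kappa> where ec: "edge_coloring T c \<kappa>"
    and nz: "\<And>v. v \<in> vertices T \<Longrightarrow> \<kappa> v \<in> {color1, color2, color3}"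
    and proper: "proper_edge_coloring T \<kappa>"
    using valid by (auto simp: valid_coloring_def)
  obtain \<kappa>' where ec': "edge_coloring T c \<kappa>'" and rs': "rigid_signs T (derived_sign \<kappa>')"
    using rigid by (auto simp: rigid_on_def)
  \<comment> \<open>Validity and rigidity are each witnessed by an edge coloring; the two agree on the edges of \<open>T\<close>.\<close>
  have "derived_sign \<kappa> u = derived_sign \<kappa>' u" if "u \<in> internals T" for u
    using that edge_coloring_unique[OF ec ec'] snoc_in_vertices_iff[of u _ T]
    by (simp add: derived_sign_def vertices_def)
  then have alternate: "derived_sign \<kappa> u \<noteq> derived_sign \<kappa> (u @ [x])"
    if "u @ [x] \<in> internals T" for u x
    using rs' that internals_snoc_imp[OF that] unfolding rigid_signs_def by metis
  have nonzero: "\<kappa> v \<noteq> 0" if "v \<in> vertices T" for v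
    using nz[OF that] by (auto simp: zero_prod_def)
  have sum0: "\<kappa> u + \<kappa> (u @ [False]) + \<kappa> (u @ [True]) = 0" if "u \<in> internals T" for u
    using ec that by (simp add: edge_coloring_def)
  have parent: "\<kappa> u = third (\<kappa> (u @ [True]), \<kappa> (u @ [False]))" if "u \<in> internals T" for u
    using sum0[OF that] color_add_self unfolding third_def
    by (metis add.left_neutral fst_conv snd_conv)
  have sign: "derived_sign \<kappa> u = (if positive (\<kappa> (u @ [True]), \<kappa> (u @ [False])) then Plus else Minus)"
    if "u \<in> internals T" for u
    using derived_sign_positive[of \<kappa> u] parent[OF that] by simp
  have child_nonzero: "\<kappa> (u @ [x]) \<noteq> 0" if "u \<in> internals T" for u x
    using nonzero that snoc_in_vertices_iff by blast
  obtain e where e: "nondegenerate e" "third e = \<kappa> []"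
    and e_children: "[] \<in> internals T \<Longrightarrow> e = (\<kappa> [True], \<kappa> [False])"
  proof (cases "[] \<in> internals T")
    case True
    show thesis
    proof (rule that)
      show "nondegenerate (\<kappa> [True], \<kappa> [False])"
        using True proper child_nonzero[OF True]
        by (auto simp: nondegenerate_def proper_edge_coloring_def dest!: bspec[of _ _ "[]"])
    qed (use parent[OF True] in auto)
  next
    case False
    have "\<exists>e. nondegenerate e \<and> third e = \<kappa> []"
      using nonzero[OF Nil_in_vertices]
      by (cases "\<kappa> []" rule: color_cases)
        (simp_all add: zero_prod_def nondegenerate_def third_def, fastforce+)
    then show thesis using False that by blast
  qed
  define E where "E = subdivide (+) e"
  have nd: "nondegenerate (E w)" for w
    using subdivide_nondegenerate[OF e(1)] by (auto simp: E_def)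
  have E: "(\<kappa> (u @ [True]), \<kappa> (u @ [False])) = E u" if "u \<in> internals T" for u
    using that
  proof (induction u rule: rev_induct)
    case Nil
    then show ?case using e_children by (simp add: E_def)
  next
    case (snoc x u)
    have u: "u \<in> internals T" using internals_snoc_imp[OF snoc.prems] .
    note IH = snoc.IH[OF u]
    let ?z = "\<kappa> ((u @ [x]) @ [True])" and ?y = "\<kappa> ((u @ [x]) @ [False])"
    have opposite: "positive (?z, ?y) \<longleftrightarrow> \<not> positive (fst (E u), snd (E u))"
      using alternate[OF snoc.prems] sign[OF snoc.prems] sign[OF u] IH by (auto split: if_splits)
    have "nondegenerate (fst (E u), snd (E u))" using nd by simp
    note triple = opposite_triple[OF this child_nonzero[OF snoc.prems] child_nonzero[OF snoc.prems] opposite]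
    have sum: "\<kappa> (u @ [x]) + ?y + ?z = 0" by (rule sum0[OF snoc.prems])
    show ?case
    proof (cases x)
      case True
      then have "fst (E u) + ?y + ?z = 0" using sum IH[symmetric] by simp
      from triple(1)[OF this] show ?thesis using True by (simp add: E_def subdivide_append)
    next
      case False
      then have "snd (E u) + ?y + ?z = 0" using sum IH[symmetric] by simp
      from triple(2)[OF this] show ?thesis using False by (simp add: E_def subdivide_append)
    qed
  qed
  have "\<kappa> w = third (E w)" if "w \<in> vertices T" for w
  proof (cases w rule: rev_exhaust)
    case Nil
    then show ?thesis using e(2) by (simp add: E_def)
  next
    case (snoc u x)
    then have "u \<in> internals T" using that snoc_in_vertices_iff by blast
    from E[OF this, symmetric] show ?thesis
      unfolding snoc by (cases x) (simp_all add: E_def subdivide_append third_def color_add_self)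
  qed
  then have "c = map (third \<circ> E) (leaves T)"
    using ec by (auto simp: edge_coloring_def num_leaves_def vertices_def intro!: nth_equalityI)
  then show ?thesis using e(1) unfolding E_def by blast
qed

definition same_parities :: "bintree \<Rightarrow> bintree \<Rightarrow> bool" where
  "same_parities D R \<longleftrightarrow>
     list_all2 (\<lambda>u v. even (length u) = even (length v)) (leaves D) (leaves R)"

lemma same_parities_trans: "same_parities D S \<Longrightarrow> same_parities S R \<Longrightarrow> same_parities D R"
  by (simp add: same_parities_def list_all2_conv_all_nth)

lemma same_parities_sym: "same_parities D R \<Longrightarrow> same_parities R D"
  by (simp add: same_parities_def list_all2_conv_all_nth)

theorem ex_rigid_coloring_iff: "(\<exists>c. rigid_coloring D R c) \<longleftrightarrow> same_parities D R"
proof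
  assume "\<exists>c. rigid_coloring D R c"
  then obtain c where "valid_coloring D c" "rigid_on D c" "valid_coloring R c" "rigid_on R c"
    by (auto simp: rigid_coloring_def coloring_of_pair_def)
  then obtain e e' where e: "nondegenerate e" "c = map (third \<circ> subdivide (+) e) (leaves D)"
    and e': "nondegenerate e'" "c = map (third \<circ> subdivide (+) e') (leaves R)"
    using rigid_coloring_is_subdivision by metis
  let ?es = "map (subdivide (+) e) (leaves D)" and ?es' = "map (subdivide (+) e') (leaves R)"
  have thirds: "map third ?es = map third ?es'"
    using e(2) e'(2) by simp
  have ch: "chain (fst e) ?es (snd e)" "chain (fst e') ?es' (snd e')"
    by (rule chain_leaves)+
  have "third e = third e'"
    using chain_sum[OF ch(1)] chain_sum[OF ch(2)] thirds by (simp add: third_def)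
  then have root: "positive e = positive e' \<longleftrightarrow> fst e = fst e'"
    using same_third(2)[of "fst e" "snd e" "fst e'" "snd e'"] e(1) e'(1) by simp
  have "list_all2 (=) (map third ?es) (map third ?es')"
    using thirds by (simp only: list.rel_eq)
  then have "list_all2 (\<lambda>x y. nondegenerate x \<and> nondegenerate y \<and> third x = third y) ?es ?es'"
    using e(1) e'(1) by (simp add: list.rel_map subdivide_nondegenerate)
  from chain_same_thirds[OF this ch]
  have "list_all2 (\<lambda>u v. positive (subdivide (+) e u) = positive (subdivide (+) e' v) \<longleftrightarrow>
      positive e = positive e') (leaves D) (leaves R)"
    by (simp add: root list_all2_map1 list_all2_map2)
  then show "same_parities D R"
    unfolding same_parities_def
    by (rule list_all2_mono) (use e(1) e'(1) subdivide_nondegenerate(2) in metis)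
next
  assume par: "same_parities D R"
  \<comment> \<open>Any two different nonzero colors for the points 0 and 1 would do.\<close>
  define e where "e = (color1, color2)"
  have e: "nondegenerate e" by (simp add: e_def nondegenerate_def zero_prod_def)
  let ?es = "map (subdivide (+) e) (leaves D)" and ?es' = "map (subdivide (+) e) (leaves R)"
  have "list_all2 (\<lambda>x y. nondegenerate x \<and> nondegenerate y \<and> positive x = positive y) ?es ?es'"
    using par e unfolding same_parities_def list_all2_map1 list_all2_map2
    by (auto simp: subdivide_nondegenerate elim!: list_all2_mono)
  then have "?es = ?es'"
    by (rule chain_same_positive) (rule chain_leaves)+
  then have "map (third \<circ> subdivide (+) e) (leaves D) = map (third \<circ> subdivide (+) e) (leaves R)"
    by (metis map_map)
  then show "\<exists>c. rigid_coloring D R c"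
    using subdivision_coloring_rigid[OF e]
    unfolding rigid_coloring_def coloring_of_pair_def by metis
qed

section \<open>Standard dyadic intervals\<close>

text \<open>
  The increasing affine parametrization of \<open>i(w)\<close> by \<open>[0,1]\<close>.  In these coordinates the element
  given by a pair of trees just replaces a leaf word of one tree by one of the other, and
  concatenation of words becomes composition (\<open>point_append\<close>).
\<close>

definition point :: "word \<Rightarrow> real \<Rightarrow> real" where
  "point w t = fst (endpoints w) + t * (snd (endpoints w) - fst (endpoints w))"

lemma endpoints_subdivide: "endpoints w = subdivide (\<lambda>a b. (a + b) / 2) (0, 1) w"
  by (simp add: endpoints_def subdivide_def case_prod_unfold)

lemma subdivide_midpoint_affine:
  "subdivide (\<lambda>a b. (a + b) / 2) (a, b) w =
     (a + fst (endpoints w) * (b - a), a + snd (endpoints w) * (b - a))" for a b :: real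
proof (induction w arbitrary: a b)
  case Nil
  then show ?case by (simp add: endpoints_def)
next
  case (Cons x w)
  have "endpoints (x # w) = subdivide (\<lambda>a b. (a + b) / 2) (if x then (1 / 2, 1) else (0, 1 / 2)) w"
    by (simp add: endpoints_subdivide)
  also have "\<dots> = (if x then (1 / 2 + fst (endpoints w) / 2, 1 / 2 + snd (endpoints w) / 2)
      else (fst (endpoints w) / 2, snd (endpoints w) / 2))"
    by (simp add: Cons.IH)
  finally show ?case
    by (simp add: Cons.IH field_simps)
qed

lemma point_append: "point (v @ w) t = point v (point w t)"
proof -
  have "endpoints (v @ w) = (point v (fst (endpoints w)), point v (snd (endpoints w)))"
    using subdivide_midpoint_affine[of "fst (endpoints v)" "snd (endpoints v)" w]
    by (simp add: point_def endpoints_subdivide[of "v @ w"] subdivide_append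
        endpoints_subdivide[symmetric])
  then show ?thesis by (simp add: point_def algebra_simps)
qed

lemma point_Nil [simp]: "point [] t = t"
  by (simp add: point_def endpoints_def)

lemma point_Cons: "point (x # w) t = ((if x then 1 else 0) + point w t) / 2"
  using point_append[of "[x]" w t] by (simp add: point_def[of "[x]"] endpoints_def)

lemma point_eq: "point w t = fst (endpoints w) + t / 2 ^ length w"
proof -
  have "point w t - point w 0 = t / 2 ^ length w"
    by (induction w) (auto simp: point_Cons field_simps)
  then show ?thesis by (simp add: point_def)
qed

lemma point_mem:
  assumes "t \<in> {0..1}"
  shows "point w t \<in> {0..1}"
  using assms by (induction w) (auto simp: point_Cons)

lemma endpoints_point: "endpoints w = (point w 0, point w 1)"
  by (simp add: point_def)

lemma point_less_iff: "point w s < point w t \<longleftrightarrow> s < t"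
  by (simp add: point_eq divide_less_cancel)

lemma interval_point: "interval w = point w ` {0..1}"
proof -
  have "point w ` {0..1} = (\<lambda>t. (1 / 2 ^ length w) * t + fst (endpoints w)) ` {0..1}"
    by (simp add: point_eq add.commute)
  also have "\<dots> = {fst (endpoints w)..point w 1}"
    by (subst image_affinity_atLeastAtMost) (simp add: point_eq add.commute)
  finally show ?thesis by (simp add: interval_def point_def)
qed

lemma leaves_cover:
  assumes "s \<in> {0..1}"
  shows "\<exists>w\<in>set (leaves T). \<exists>t\<in>{0..1}. s = point w t"
  using assms
proof (induction T arbitrary: s)
  case Leaf
  then show ?case by simp
next
  case (Node l r)
  show ?case
  proof (cases "s \<le> 1 / 2")
    case True
    then obtain w t where "w \<in> set (leaves l)" "t \<in> {0..1}" "2 * s = point w t"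
      using Node.IH(1)[of "2 * s"] Node.prems by auto
    then have "False # w \<in> set (leaves (Node l r))" "s = point (False # w) t"
      by (auto simp: point_Cons)
    with \<open>t \<in> {0..1}\<close> show ?thesis by blast
  next
    case False
    then obtain w t where "w \<in> set (leaves r)" "t \<in> {0..1}" "2 * s - 1 = point w t"
      using Node.IH(2)[of "2 * s - 1"] Node.prems by auto
    then have "True # w \<in> set (leaves (Node l r))" "s = point (True # w) t"
      by (auto simp: point_Cons)
    with \<open>t \<in> {0..1}\<close> show ?thesis by blast
  qed
qed

section \<open>Elements of Thompson's group\<close>

definition carries :: "(real \<Rightarrow> real) \<Rightarrow> word \<Rightarrow> word \<Rightarrow> bool" where
  "carries f u v \<longleftrightarrow> (\<forall>t\<in>{0..1}. f (point u t) = point v t)"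

lemma carries_append: "carries f u v \<Longrightarrow> carries f (u @ w) (v @ w)"
  unfolding carries_def point_append using point_mem by blast

text \<open>
  An increasing affine map is determined by the interval it maps and the image interval, endpoints
  going to endpoints.
\<close>

lemma maps_affinely_onto_iff:
  "maps_affinely_onto f (interval u) (interval v) \<longleftrightarrow> carries f u v"
proof
  assume "maps_affinely_onto f (interval u) (interval v)"
  then obtain a b where a: "a > 0" and f: "\<And>x. x \<in> interval u \<Longrightarrow> f x = a * x + b"
    and img: "f ` interval u = interval v"
    by (auto simp: maps_affinely_onto_def)
  have le: "point w 0 \<le> point w 1" for w using point_less_iff[of w 0 1] by simp
  have "interval v = (\<lambda>x. a * x + b) ` interval u"
    using img f by (metis (no_types, lifting) image_cong)
  also have "\<dots> = {a * point u 0 + b..a * point u 1 + b}"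
    using a le[of u] by (auto simp: interval_def endpoints_point image_affinity_atLeastAtMost)
  finally have "{point v 0..point v 1} = {a * point u 0 + b..a * point u 1 + b}"
    by (simp add: interval_def endpoints_point)
  then have ends: "point v 0 = a * point u 0 + b" "point v 1 = a * point u 1 + b"
    using le[of v] by (auto simp: Icc_eq_Icc)
  have convex: "point w t = point w 0 + t * (point w 1 - point w 0)" for w t
    by (simp add: point_def)
  have "f (point u t) = point v t" if "t \<in> {0..1}" for t
  proof -
    have "f (point u t) = a * point u t + b" using f that by (auto simp: interval_point)
    then show ?thesis
      by (simp add: convex[of u t] convex[of v t] ends algebra_simps)
  qed
  then show "carries f u v" by (simp add: carries_def)
next
  assume c: "carries f u v"
  let ?a = "2 ^ length u / 2 ^ length v :: real"
  have "f x = ?a * x + (point v 0 - ?a * point u 0)" if "x \<in> interval u" for x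
    using that c by (auto simp: interval_point carries_def point_eq field_simps)
  moreover have "f ` interval u = interval v"
    using c by (auto simp: interval_point carries_def image_image)
  moreover have "?a > 0" by simp
  ultimately show "maps_affinely_onto f (interval u) (interval v)"
    unfolding maps_affinely_onto_def by blast
qed

lemma represents_iff:
  "represents D R f \<longleftrightarrow> f \<in> extensional {0..1} \<and> list_all2 (carries f) (leaves D) (leaves R)"
  by (auto simp: represents_def num_leaves_def maps_affinely_onto_iff list_all2_conv_all_nth)

text \<open>
  Strict monotonicity on two intervals with a common endpoint extends to their union.
\<close>

lemma strict_mono_on_chain:
  assumes "list_all2 (carries f) us vs" "chain x (map endpoints us) y"
  shows "x \<le> y \<and> strict_mono_on {x..y} f"
  using assms
proof (induction us vs arbitrary: x rule: list_all2_induct)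
  case Nil
  then show ?case by (auto simp: strict_mono_on_def)
next
  case (Cons u us v vs)
  let ?z = "point u 1"
  have x: "x = point u 0" and "chain ?z (map endpoints us) y"
    using Cons.prems by (auto simp: endpoints_point[of u])
  with Cons.IH have tail: "?z \<le> y" "strict_mono_on {?z..y} f" by auto
  have "x \<le> ?z" using point_less_iff[of u 0 1] by (simp add: x)
  have head: "f r < f s" if "r \<in> {x..?z}" "s \<in> {x..?z}" "r < s" for r s
  proof -
    have "r \<in> interval u" "s \<in> interval u"
      using that by (auto simp: interval_def endpoints_point x)
    then obtain t t' where "r = point u t" "s = point u t'" "t \<in> {0..1}" "t' \<in> {0..1}"
      by (auto simp: interval_point)
    then show ?thesis
      using Cons.hyps that(3) by (auto simp: carries_def point_less_iff)
  qed
  have "f r < f s" if "r \<in> {x..y}" "s \<in> {x..y}" "r < s" for r s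
  proof -
    consider "s \<le> ?z" | "?z \<le> r" | "r < ?z" "?z < s" by linarith
    then show ?thesis
    proof cases
      case 1
      then show ?thesis using head that by auto
    next
      case 2
      then show ?thesis using strict_mono_onD[OF tail(2)] that by auto
    next
      case 3
      then have "f r < f ?z" "f ?z < f s"
        using head[of r ?z] strict_mono_onD[OF tail(2), of ?z s] that tail(1) by auto
      then show ?thesis by simp
    qed
  qed
  with \<open>x \<le> ?z\<close> tail(1) show ?case by (auto intro: strict_mono_onI)
qed

text \<open>
  Injectivity comes from monotonicity on the chain of leaf intervals of \<open>D\<close>, surjectivity from the
  fact that the leaf intervals of \<open>R\<close> cover \<open>[0,1]\<close>.
\<close>

lemma represents_Bij:
  assumes "represents D R f"
  shows "f \<in> Bij {0..1}"
proof -
  have ext: "f \<in> extensional {0..1}" and c: "list_all2 (carries f) (leaves D) (leaves R)"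
    using assms by (auto simp: represents_iff)
  have "chain 0 (map endpoints (leaves D)) 1"
    using chain_leaves[of "(0, 1)" _ D] by (simp add: endpoints_subdivide[abs_def])
  with c have "strict_mono_on {0..1} f"
    using strict_mono_on_chain by blast
  then have inj: "inj_on f {0..1}"
    by (rule strict_mono_on_imp_inj_on)
  have "f ` {0..1} \<subseteq> {0..1}"
  proof
    fix y assume "y \<in> f ` {0..1}"
    then obtain u t where u: "u \<in> set (leaves D)" "t \<in> {0..1}" "y = f (point u t)"
      using leaves_cover[of _ D] by (metis imageE)
    with c obtain v where "carries f u v"
      by (auto simp: list_all2_conv_all_nth in_set_conv_nth)
    with u point_mem show "y \<in> {0..1}" by (auto simp: carries_def)
  qed
  moreover have "{0..1} \<subseteq> f ` {0..1}"
  proof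
    fix y :: real assume "y \<in> {0..1}"
    then obtain v t where v: "v \<in> set (leaves R)" "t \<in> {0..1}" "y = point v t"
      using leaves_cover[of y R] by blast
    with c obtain u where "carries f u v"
      by (metis list_all2_conv_all_nth in_set_conv_nth)
    with v have "y = f (point u t)" by (simp add: carries_def)
    with v point_mem show "y \<in> f ` {0..1}" by blast
  qed
  ultimately show ?thesis
    using ext inj by (auto simp: Bij_def bij_betw_def)
qed

lemma represents_one: "represents T T (\<lambda>x\<in>{0..1}. x)"
  using point_mem
  by (auto simp: represents_iff list_all2_same carries_def)

lemma represents_inverse:
  assumes "represents D R f"
  shows "represents R D (\<lambda>x\<in>{0..1}. inv_into {0..1} f x)"
proof -
  have "inj_on f {0..1}"
    using represents_Bij[OF assms] by (simp add: Bij_def bij_betw_def)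
  then have "carries (\<lambda>x\<in>{0..1}. inv_into {0..1} f x) v u" if "carries f u v" for u v
    using that point_mem unfolding carries_def
    by (metis inv_into_f_f restrict_apply')
  then show ?thesis
    using assms by (auto simp: represents_iff list_all2_conv_all_nth)
qed

lemma represents_compose:
  assumes "represents D S g" "represents S R f"
  shows "represents D R (compose {0..1} f g)"
proof -
  have "carries (compose {0..1} f g) u w" if "carries g u v" "carries f v w" for u v w
    using that point_mem by (auto simp: carries_def compose_def)
  then have "list_all2 (carries (compose {0..1} f g)) (leaves D) (leaves R)"
    using assms list_all2_trans[of "carries g" "carries f"] unfolding represents_iff by blast
  then show ?thesis by (simp add: represents_iff)
qed

section \<open>Common expansions\<close>

text \<open>
  Grafting the tree \<open>ts ! j\<close> onto the leaf \<open>ws ! j\<close> for every \<open>j\<close>.  It is defined on leaf lists and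
  not on trees, so that the same \<open>ts\<close> can be grafted onto both trees of a pair.
\<close>

definition expand :: "word list \<Rightarrow> bintree list \<Rightarrow> word list" where
  "expand ws ts = concat (map2 (\<lambda>w t. map ((@) w) (leaves t)) ws ts)"

lemma expand_Nil [simp]: "expand [] ts = []"
  by (simp add: expand_def)

lemma expand_Cons [simp]: "expand (w # ws) (t # ts) = map ((@) w) (leaves t) @ expand ws ts"
  by (simp add: expand_def)

lemma expand_append:
  "length ws = length ts \<Longrightarrow> expand (ws @ ws') (ts @ ts') = expand ws ts @ expand ws' ts'"
  by (simp add: expand_def)

lemma expand_map_Cons: "expand (map ((#) x) ws) ts = map ((#) x) (expand ws ts)"
proof (induction ws arbitrary: ts)
  case Nil
  then show ?case by simp
next
  case (Cons w ws)
  then show ?case by (cases ts) (auto simp: expand_def)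
qed

lemma expand_root: "expand [[]] [t] = leaves t"
  by (simp add: map_idI)

lemma expand_Leaf: "expand ws (replicate (length ws) Leaf) = ws"
  by (induction ws) auto

lemma expand_leaves:
  assumes "length ts = num_leaves T"
  shows "\<exists>T'. leaves T' = expand (leaves T) ts"
  using assms
proof (induction T arbitrary: ts)
  case Leaf
  then obtain t where "ts = [t]" by (auto simp: num_leaves_def length_Suc_conv)
  then show ?case by (intro exI[of _ t]) (simp add: expand_root del: expand_Cons)
next
  case (Node l r)
  let ?n = "num_leaves l"
  obtain l' r' where "leaves l' = expand (leaves l) (take ?n ts)"
    and "leaves r' = expand (leaves r) (drop ?n ts)"
    using Node.IH(1)[of "take ?n ts"] Node.IH(2)[of "drop ?n ts"] Node.prems
    by (auto simp: num_leaves_def)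
  moreover have "expand (leaves (Node l r)) (take ?n ts @ drop ?n ts) =
      map ((#) False) (expand (leaves l) (take ?n ts)) @ map ((#) True) (expand (leaves r) (drop ?n ts))"
    using Node.prems
    by (simp add: expand_append expand_map_Cons num_leaves_def del: append_take_drop_id)
  ultimately show ?case by (intro exI[of _ "Node l' r'"]) simp
qed

text \<open>
  Overlay the two trees: wherever one of them stops, graft the rest of the other.
\<close>

lemma common_expansion:
  "\<exists>ss ts. length ss = num_leaves S \<and> length ts = num_leaves T \<and>
     expand (leaves S) ss = expand (leaves T) ts"
proof (induction S arbitrary: T)
  case Leaf
  then show ?case
    by (rule exI[of _ "[T]"], rule exI[of _ "replicate (num_leaves T) Leaf"])
      (simp add: num_leaves_def expand_Leaf expand_root del: expand_Cons)
next
  case (Node l r)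
  show ?case
  proof (cases T)
    case Leaf
    show ?thesis unfolding \<open>T = Leaf\<close>
      by (rule exI[of _ "replicate (num_leaves (Node l r)) Leaf"], rule exI[of _ "[Node l r]"])
        (simp add: num_leaves_def expand_Leaf[of "leaves (Node l r)", simplified] expand_root
          del: expand_Cons)
  next
    case T: (Node l' r')
    obtain ls ls' where "length ls = num_leaves l" "length ls' = num_leaves l'"
      "expand (leaves l) ls = expand (leaves l') ls'"
      using Node.IH(1) by blast
    moreover obtain rs rs' where "length rs = num_leaves r" "length rs' = num_leaves r'"
      "expand (leaves r) rs = expand (leaves r') rs'"
      using Node.IH(2) by blast
    ultimately show ?thesis
      by - (rule exI[of _ "ls @ rs"], rule exI[of _ "ls' @ rs'"],
        simp add: T num_leaves_def expand_append expand_map_Cons)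
  qed
qed

lemma expand_list_all2:
  assumes "list_all2 P us vs" "\<And>u v w. P u v \<Longrightarrow> P (u @ w) (v @ w)"
  shows "list_all2 P (expand us ts) (expand vs ts)"
  using assms(1)
proof (induction us vs arbitrary: ts rule: list_all2_induct)
  case Nil
  then show ?case by simp
next
  case (Cons u us v vs)
  show ?case
  proof (cases ts)
    case Nil
    then show ?thesis by (simp add: expand_def)
  next
    case (Cons t ts')
    have "list_all2 P (map ((@) u) (leaves t)) (map ((@) v) (leaves t))"
      using \<open>P u v\<close> assms(2) by (simp add: list.rel_map list_all2_same)
    with Cons \<open>list_all2 P (expand us ts') (expand vs ts')\<close> show ?thesis
      by (simp add: list_all2_appendI)
  qed
qed

definition even_pair :: "bintree \<Rightarrow> bintree \<Rightarrow> (real \<Rightarrow> real) \<Rightarrow> bool" where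
  "even_pair D R f \<longleftrightarrow> represents D R f \<and> same_parities D R"

lemma even_pair_expand:
  assumes "even_pair D R f" "leaves D' = expand (leaves D) ts" "leaves R' = expand (leaves R) ts"
  shows "even_pair D' R' f"
proof -
  have "list_all2 (carries f) (leaves D') (leaves R')"
    unfolding assms(2,3) using assms(1)
    by (intro expand_list_all2)
      (auto simp: even_pair_def represents_iff carries_append)
  moreover have "same_parities D' R'"
    unfolding same_parities_def assms(2,3) using assms(1)
    by (intro expand_list_all2) (auto simp: even_pair_def same_parities_def)
  ultimately show ?thesis
    using assms(1) by (simp add: even_pair_def represents_iff)
qed

text \<open>
  Expand the two pairs until the range tree \<open>S\<close> of \<open>g\<close> is the domain tree of \<open>f\<close>; parities of depths
  then agree along \<open>D1\<close>, \<open>S\<close>, \<open>R1\<close>.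
\<close>

lemma even_pair_compose:
  assumes "even_pair D R g" "even_pair D' R' f"
  shows "\<exists>D'' R''. even_pair D'' R'' (compose {0..1} f g)"
proof -
  obtain rs ds where rs: "length rs = num_leaves R" and ds: "length ds = num_leaves D'"
    and eq: "expand (leaves R) rs = expand (leaves D') ds"
    using common_expansion by blast
  have "num_leaves D = num_leaves R" "num_leaves D' = num_leaves R'"
    using assms by (auto simp: even_pair_def represents_def)
  then obtain D1 S R1 where D1: "leaves D1 = expand (leaves D) rs"
    and S: "leaves S = expand (leaves R) rs" and R1: "leaves R1 = expand (leaves R') ds"
    using expand_leaves rs ds by metis
  have "even_pair D1 S g" "even_pair S R1 f"
    using even_pair_expand assms D1 S R1 eq by metis+
  then have "even_pair D1 R1 (compose {0..1} f g)"
    unfolding even_pair_def using represents_compose same_parities_trans by blast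
  then show ?thesis by blast
qed

lemma F4_iff: "f \<in> F4 \<longleftrightarrow> (\<exists>D R. even_pair D R f)"
  by (auto simp: F4_def has_rigid_coloring_def thompson_F_def even_pair_def
      ex_rigid_coloring_iff[symmetric])

section \<open>Slopes\<close>

lemma power_of_four_iff: "(\<exists>k::int. (2::real) powi m = 4 powi k) \<longleftrightarrow> even m"
proof -
  have four: "(4::real) powi k = 2 powi (2 * k)" for k
    by (simp add: power_int_mult)
  have "(2::real) powi m = 2 powi n \<longleftrightarrow> m = n" for n
    using power_int_strict_increasing[of m n "2::real"] power_int_strict_increasing[of n m "2::real"]
    by (cases m n rule: linorder_cases) auto
  then show ?thesis
    by (auto simp: four)
qed

lemma carries_slope:
  assumes "carries f u v" "x \<in> interval u"
  shows "(f has_real_derivative 2 powi (int (length u) - int (length v))) (at x within interval u)"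
proof -
  let ?s = "(2::real) powi (int (length u) - int (length v))"
  have s: "?s = 2 ^ length u / 2 ^ length v"
    by (simp add: power_int_diff)
  have "((\<lambda>y. point v 0 + ?s * (y - point u 0)) has_real_derivative ?s) (at x within interval u)"
    by (auto intro!: derivative_eq_intros)
  then show ?thesis
  proof (rule has_field_derivative_transform_within[where d = 1])
    fix y assume "y \<in> interval u"
    then show "point v 0 + ?s * (y - point u 0) = f y"
      using assms(1) by (auto simp: interval_point carries_def s point_eq)
  qed (use assms(2) in auto)
qed

text \<open>
  Every point of differentiability lies in some leaf interval, possibly as an endpoint.  The
  derivative at the point is also the derivative within this interval, so that breakpoints between
  two leaf intervals contribute no further slopes.  Conversely, each slope occurs at the midpoint of
  its interval.
\<close>

lemma slopes_eq:
  assumes "represents D R f"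
  shows "slopes f = (\<lambda>(u, v). 2 powi (int (length u) - int (length v))) ` set (zip (leaves D) (leaves R))"
    (is "_ = ?slope ` ?Z")
proof
  have carries: "carries f u v" if "(u, v) \<in> ?Z" for u v
    using assms that by (auto simp: represents_iff list_all2_iff)
  have length: "length (leaves D) = length (leaves R)"
    using assms by (simp add: represents_def num_leaves_def)
  show "slopes f \<subseteq> ?slope ` ?Z"
  proof
    fix s assume "s \<in> slopes f"
    then obtain x where x: "x \<in> {0<..<1}" "(f has_real_derivative s) (at x)"
      by (auto simp: slopes_def)
    then obtain u t where u: "u \<in> set (leaves D)" "t \<in> {0..1}" "x = point u t"
      using leaves_cover[of x D] by auto
    then obtain v where v: "(u, v) \<in> ?Z"
      using length by (metis in_set_impl_in_set_zip1)
    have ux: "x \<in> interval u" using u by (auto simp: interval_point)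
    have "s = ?slope (u, v)"
    proof (rule has_field_derivative_unique)
      show "(f has_real_derivative s) (at x within interval u)"
        using x(2) by (rule has_field_derivative_at_within)
      show "(f has_real_derivative ?slope (u, v)) (at x within interval u)"
        using carries_slope[OF carries[OF v] ux] by simp
      show "at x within interval u \<noteq> bot"
        using ux point_less_iff[of u 0 1]
        by (simp add: interval_def endpoints_point trivial_limit_within islimpt_Icc)
    qed
    with v show "s \<in> ?slope ` ?Z" by blast
  qed
  show "?slope ` ?Z \<subseteq> slopes f"
  proof clarify
    fix u v assume Z: "(u, v) \<in> ?Z"
    let ?x = "point u (1 / 2)"
    have int: "?x \<in> interior (interval u)"
      by (simp add: interval_def endpoints_point point_less_iff)
    then have "(f has_real_derivative ?slope (u, v)) (at ?x)"
      using carries_slope[OF carries[OF Z], of ?x] interior_subset at_within_interior by force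
    moreover have "?x \<in> {0<..<1}"
      using point_less_iff[of u 0 "1 / 2"] point_less_iff[of u "1 / 2" 1]
        point_mem[of 0 u] point_mem[of 1 u] by simp
    ultimately show "2 powi (int (length u) - int (length v)) \<in> slopes f"
      unfolding slopes_def by auto
  qed
qed

lemma slopes_powers_of_four_iff:
  assumes "represents D R f"
  shows "(\<forall>s\<in>slopes f. \<exists>k::int. s = 4 powi k) \<longleftrightarrow> same_parities D R"
proof -
  have "length (leaves D) = length (leaves R)"
    using assms by (simp add: represents_def num_leaves_def)
  then show ?thesis
    by (simp add: slopes_eq[OF assms] case_prod_unfold power_of_four_iff same_parities_def
        list_all2_iff)
qed

section \<open>The subgroup\<close>

lemma mult_thompson_F:
  assumes "f \<in> carrier thompson_F" "g \<in> carrier thompson_F"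
  shows "f \<otimes>\<^bsub>thompson_F\<^esub> g = compose {0..1} f g"
  using assms represents_Bij by (auto simp: thompson_F_def BijGroup_def)

lemma one_thompson_F: "\<one>\<^bsub>thompson_F\<^esub> = (\<lambda>x\<in>{0..1}. x)"
  by (simp add: thompson_F_def BijGroup_def)

text \<open>
  The inverse in \<open>thompson_F\<close> is defined by its uniqueness in the carrier, which is inherited from
  the group of all bijections.
\<close>

lemma inv_thompson_F:
  assumes "f \<in> carrier thompson_F"
  shows "inv\<^bsub>thompson_F\<^esub> f = (\<lambda>x\<in>{0..1}. inv_into {0..1} f x)"
proof -
  let ?g = "\<lambda>x\<in>{0..1}. inv_into {0..1} f x"
  have Bij: "h \<in> Bij {0..1}" if "h \<in> carrier thompson_F" for h
    using that represents_Bij by (auto simp: thompson_F_def)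
  interpret B: group "BijGroup {0..1::real}" by (rule group_BijGroup)
  have f: "f \<in> Bij {0..1}" using Bij assms .
  have g: "?g \<in> carrier thompson_F"
    using assms represents_inverse[of _ _ f] by (auto simp: thompson_F_def)
  have gf: "compose {0..1} ?g f = (\<lambda>x\<in>{0..1}. x)"
    using Bij_compose_restrict_eq[OF f] .
  have fg: "compose {0..1} f ?g = (\<lambda>x\<in>{0..1}. x)"
    using f by (intro compose_id_inv_into) (simp add: Bij_def bij_betw_def)
  have unique: "h = ?g" if h: "h \<in> carrier thompson_F" "f \<otimes>\<^bsub>thompson_F\<^esub> h = \<one>\<^bsub>thompson_F\<^esub>" for h
  proof -
    have fh: "compose {0..1} f h = (\<lambda>x\<in>{0..1}. x)"
      using h assms by (simp add: mult_thompson_F one_thompson_F)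
    have mult: "k \<otimes>\<^bsub>BijGroup {0..1}\<^esub> l = compose {0..1} k l" if "k \<in> Bij {0..1}" "l \<in> Bij {0..1}"
      for k l :: "real \<Rightarrow> real"
      using that by (simp add: BijGroup_def)
    have one: "\<one>\<^bsub>BijGroup {0..1::real}\<^esub> = (\<lambda>x\<in>{0..1}. x)"
      and carrier: "carrier (BijGroup {0..1::real}) = Bij {0..1}"
      by (simp_all add: BijGroup_def)
    have "?g = h"
    proof (rule B.inv_unique[of ?g f h])
      show "?g \<otimes>\<^bsub>BijGroup {0..1}\<^esub> f = \<one>\<^bsub>BijGroup {0..1}\<^esub>"
        unfolding mult[OF Bij[OF g] f] one by (rule gf)
      show "f \<otimes>\<^bsub>BijGroup {0..1}\<^esub> h = \<one>\<^bsub>BijGroup {0..1}\<^esub>"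
        unfolding mult[OF f Bij[OF h(1)]] one by (rule fh)
    qed (simp_all only: carrier f Bij[OF g] Bij[OF h(1)])
    then show ?thesis by (rule sym)
  qed
  show ?thesis
    unfolding m_inv_def
  proof (rule the_equality)
    show "?g \<in> carrier thompson_F \<and> f \<otimes>\<^bsub>thompson_F\<^esub> ?g = \<one>\<^bsub>thompson_F\<^esub> \<and>
        ?g \<otimes>\<^bsub>thompson_F\<^esub> f = \<one>\<^bsub>thompson_F\<^esub>"
      unfolding mult_thompson_F[OF assms g] mult_thompson_F[OF g assms] one_thompson_F
      using g gf fg by blast
  qed (blast intro: unique)
qed

theorem proposition9p3:
  "subgroup F4 thompson_F \<and>
   F4 = {f \<in> carrier thompson_F. \<forall>s\<in>slopes f. \<exists>k::int. s = 4 powi k}"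
proof
  have carrier: "F4 \<subseteq> carrier thompson_F"
    by (auto simp: F4_def)
  show "subgroup F4 thompson_F"
  proof
    show "F4 \<subseteq> carrier thompson_F" by (rule carrier)
    show "f \<otimes>\<^bsub>thompson_F\<^esub> g \<in> F4" if "f \<in> F4" "g \<in> F4" for f g
    proof -
      have "f \<otimes>\<^bsub>thompson_F\<^esub> g = compose {0..1} f g"
        using that carrier by (auto intro: mult_thompson_F)
      then show ?thesis
        using that even_pair_compose by (auto simp: F4_iff)
    qed
    have "even_pair Leaf Leaf (\<lambda>x\<in>{0..1}. x)"
      using represents_one by (simp add: even_pair_def same_parities_def)
    then show "\<one>\<^bsub>thompson_F\<^esub> \<in> F4"
      by (auto simp: F4_iff one_thompson_F)
    show "inv\<^bsub>thompson_F\<^esub> f \<in> F4" if f: "f \<in> F4" for f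
    proof -
      obtain D R where "even_pair D R f" using f by (auto simp: F4_iff)
      then have "even_pair R D (\<lambda>x\<in>{0..1}. inv_into {0..1} f x)"
        using represents_inverse same_parities_sym by (simp add: even_pair_def)
      moreover have "inv\<^bsub>thompson_F\<^esub> f = (\<lambda>x\<in>{0..1}. inv_into {0..1} f x)"
        using f carrier by (intro inv_thompson_F) auto
      ultimately show ?thesis by (auto simp: F4_iff)
    qed
  qed
  show "F4 = {f \<in> carrier thompson_F. \<forall>s\<in>slopes f. \<exists>k::int. s = 4 powi k}"
    using slopes_powers_of_four_iff
    unfolding set_eq_iff F4_iff even_pair_def thompson_F_def by simp blast
qed

end
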